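(* Let $\mathcal P\in\{\mathcal{ISP},\mathcal{HISP}\}$, where $\mathcal{ISP}$ is the initial specification property and $\mathcal{HISP}$ is the Hausdorff initial specification property of CR-dynamical systems. Then the following hold. (1) $\mathcal P$ is a CR-dynamical property that generalizes the initial specification property (of dynamical systems). (2) For any dynamical system $(X,f)$, if $(X,f)$ has the initial specification property, then $(X,f)$ has $\mathrm{Power}(\mathcal P)$.
   Context: A dynamical system is a pair $(X,f)$ where $X$ is a non-empty compact metric space with metric $d$ and $f:X\to X$ is continuous. Two dynamical systems $(X,f)$, $(Y,g)$ are topological conjugates if there is a homeomorphism $\varphi:X\to Y$ with $\varphi\circ f=g\circ\varphi$. A CR-dynamical system is a pair $(X,F)$ where $X$ is a non-empty compact metric space and $F\subseteq X\times X$ is closed in $X\times X$; a dynamical system $(X,f)$ is regarded as a CR-dynamical system by identifying $f$ with its graph. CR-dynamical systems $(X,F)$, $(Y,G)$ are topological conjugates if there is a homeomorphism $\varphi:X\to Y$ with $(x,y)\in F\Leftrightarrow(\varphi(x),\varphi(y))\in G$ for all $(x,y)\in X\times X$. Initial specification property of a dynamical system $(X,f)$: for each $\varepsilon>0$ there is a positive integer $N$ such that for every positive integer $n$, all integers $m_1,\ldots,m_{n-1}\ge N$, all points $x_1,\ldots,x_n\in X$ and all non-negative integers $\ell_1,\ldots,\ell_n$, there is $y\in X$ with $d\big(f^{\,j+\sum_{r=1}^{i-1}(\ell_r+m_r)}(y),f^j(x_i)\big)\le\varepsilon$ for all $i\in\{1,\ldots,n\}$ and $j\in\{0,\ldots,\ell_i\}$.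 For a CR-dynamical system $(X,F)$: $F(x)=\{y:(x,y)\in F\}$, $F(A)=\bigcup_{a\in A}F(a)$, $F^0(x)=\{x\}$, $F^{k+1}(x)=F(F^k(x))$. For non-empty $A,B\subseteq X$, $d(A,B)=\inf\{d(a,b):a\in A,b\in B\}$; $H_d$ is the Hausdorff metric on the set of non-empty closed subsets of $X$. An inequality $d(A,B)\le\varepsilon$ or $H_d(A,B)\le\varepsilon$ is understood to hold only if $A,B$ are non-empty. Write $F^{[0,\ell]}(x)=(F^0(x),\ldots,F^\ell(x))$. An initial $n$-specification in $(X,F)$ is a tuple $\mathcal S=(F^{[0,\ell_1]}(x_1),\ldots,F^{[0,\ell_n]}(x_n))$ with $x_j\in X$ and integers $\ell_j\ge0$ (these data being part of $\mathcal S$). For positive integers $m_1,\ldots,m_{n-1}$, $\mathcal S$ is $(\varepsilon,m_1,\ldots,m_{n-1})$-traced (respectively Hausdorff $(\varepsilon,m_1,\ldots,m_{n-1})$-traced) in $(X,F)$ by $y\in X$ if, with $s_i=\sum_{r=1}^{i-1}(\ell_r+m_r)$, $d(F^{s_i+j}(y),F^j(x_i))\le\varepsilon$ (respectively $H_d(F^{s_i+j}(y),F^j(x_i))\le\varepsilon$) for all $i\in\{1,\ldots,n\}$ and $j\in\{0,\ldots,\ell_i\}$. $(X,F)$ has the initial specification property $\mathcal{ISP}$ (respectively the Hausdorff initial specification property $\mathcal{HISP}$) if for each $\varepsilon>0$ there is a positive integer $N$ such that for each positive integer $n$, all integers $m_1,\ldots,m_{n-1}\ge N$ and every initial $n$-specification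 $\mathcal S$ in $(X,F)$, there is $y\in X$ such that $\mathcal S$ is $(\varepsilon,m_1,\ldots,m_{n-1})$-traced (respectively Hausdorff $(\varepsilon,m_1,\ldots,m_{n-1})$-traced) in $(X,F)$ by $y$. A property $\mathcal P$ of CR-dynamical systems is a CR-dynamical property if it is preserved under topological conjugacy of CR-dynamical systems. It generalizes a property $\mathcal R$ of dynamical systems if for each dynamical system $(X,f)$: $(X,f)$ has $\mathcal P$ (as a CR-dynamical system) if and only if $(X,f)$ has $\mathcal R$. For a CR-dynamical system $(Z,F)$, $Z_F^+=\{(x_1,x_2,\ldots)\in\prod_{i=1}^\infty Z:(x_i,x_{i+1})\in F\text{ for all }i\ge1\}$ with the product topology and $\sigma_F^+(x_1,x_2,x_3,\ldots)=(x_2,x_3,\ldots)$. A dynamical system $(X,f)$ has $\mathrm{Power}(\mathcal P)$ (is powered by $\mathcal P$) if there is a CR-dynamical system $(Z,F)$ having property $\mathcal P$ such that $(X,f)$ and $(Z_F^+,\sigma_F^+)$ are topological conjugates. *)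

theory Defs
  imports "HOL-Analysis.Analysis"
begin

section \<open>Dynamical systems and CR-dynamical systems\<close>

definition dynamical_system :: "'a metric \<Rightarrow> ('a \<Rightarrow> 'a) \<Rightarrow> bool" where
  "dynamical_system X f \<longleftrightarrow>
     mspace X \<noteq> {} \<and> compact_space (mtopology_of X) \<and>
     continuous_map (mtopology_of X) (mtopology_of X) f"

definition CR_dynamical_system :: "'a metric \<Rightarrow> ('a \<times> 'a) set \<Rightarrow> bool" where
  "CR_dynamical_system X F \<longleftrightarrow>
     mspace X \<noteq> {} \<and> compact_space (mtopology_of X) \<and>
     closedin (prod_topology (mtopology_of X) (mtopology_of X)) F"

definition graph_on :: "'a metric \<Rightarrow> ('a \<Rightarrow> 'a) \<Rightarrow> ('a \<times> 'a) set" where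
  "graph_on X f = {(x, f x) | x. x \<in> mspace X}"

text \<open>Conjugacy of dynamical systems is purely topological. It is stated for topologies so that
  it applies to the shift on an infinite product without fixing a metric there.\<close>

definition topologically_conjugate ::
    "'a topology \<Rightarrow> ('a \<Rightarrow> 'a) \<Rightarrow> 'b topology \<Rightarrow> ('b \<Rightarrow> 'b) \<Rightarrow> bool" where
  "topologically_conjugate S f T g \<longleftrightarrow>
     (\<exists>\<phi>. homeomorphic_map S T \<phi> \<and> (\<forall>x\<in>topspace S. \<phi> (f x) = g (\<phi> x)))"

definition CR_topologically_conjugate ::
    "'a metric \<Rightarrow> ('a \<times> 'a) set \<Rightarrow> 'b metric \<Rightarrow> ('b \<times> 'b) set \<Rightarrow> bool" where
  "CR_topologically_conjugate X F Y G \<longleftrightarrow>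
     (\<exists>\<phi>. homeomorphic_map (mtopology_of X) (mtopology_of Y) \<phi> \<and>
          (\<forall>x\<in>mspace X. \<forall>y\<in>mspace X. (x, y) \<in> F \<longleftrightarrow> (\<phi> x, \<phi> y) \<in> G))"


section \<open>Specification properties\<close>

text \<open>Tuples indexed by \<open>1, \<dots>, n\<close> are given by functions on \<open>nat\<close> of which only the
  values at the relevant indices are used: \<open>x\<close> and \<open>l\<close> at \<open>1, \<dots>, n\<close>, and \<open>m\<close> at
  \<open>1, \<dots>, n - 1\<close>.\<close>

definition segment_start :: "(nat \<Rightarrow> nat) \<Rightarrow> (nat \<Rightarrow> nat) \<Rightarrow> nat \<Rightarrow> nat" where
  "segment_start l m i = (\<Sum>r = 1..<i. l r + m r)"

definition initial_specification_property :: "'a metric \<Rightarrow> ('a \<Rightarrow> 'a) \<Rightarrow> bool" where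
  "initial_specification_property X f \<longleftrightarrow>
     (\<forall>\<epsilon>>0. \<exists>N>0. \<forall>n>0. \<forall>m. (\<forall>r\<in>{1..<n}. N \<le> m r) \<longrightarrow>
       (\<forall>x l. (\<forall>i\<in>{1..n}. x i \<in> mspace X) \<longrightarrow>
         (\<exists>y\<in>mspace X. \<forall>i\<in>{1..n}. \<forall>j\<in>{0..l i}.
            mdist X ((f ^^ (j + segment_start l m i)) y) ((f ^^ j) (x i)) \<le> \<epsilon>)))"

definition set_iterate :: "('a \<times> 'a) set \<Rightarrow> nat \<Rightarrow> 'a \<Rightarrow> 'a set" where
  "set_iterate F k x = ((\<lambda>A. F `` A) ^^ k) {x}"

definition set_distance :: "'a metric \<Rightarrow> 'a set \<Rightarrow> 'a set \<Rightarrow> real" where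
  "set_distance X A B = Inf {mdist X a b | a b. a \<in> A \<and> b \<in> B}"

definition hausdorff_distance :: "'a metric \<Rightarrow> 'a set \<Rightarrow> 'a set \<Rightarrow> real" where
  "hausdorff_distance X A B =
     Inf {r. 0 < r \<and> A \<subseteq> (\<Union>b\<in>B. mball_of X b r) \<and> B \<subseteq> (\<Union>a\<in>A. mball_of X a r)}"

text \<open>The iterates of a closed relation at a point may be empty; tracing explicitly demands that
  they are not, since \<^term>\<open>Inf {} :: real\<close> carries no information.\<close>

definition traced :: "'a metric \<Rightarrow> ('a \<times> 'a) set \<Rightarrow> real \<Rightarrow> nat \<Rightarrow> (nat \<Rightarrow> nat) \<Rightarrow>
    (nat \<Rightarrow> 'a) \<Rightarrow> (nat \<Rightarrow> nat) \<Rightarrow> 'a \<Rightarrow> bool" where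
  "traced X F \<epsilon> n m x l y \<longleftrightarrow>
     (\<forall>i\<in>{1..n}. \<forall>j\<in>{0..l i}.
        set_iterate F (segment_start l m i + j) y \<noteq> {} \<and> set_iterate F j (x i) \<noteq> {} \<and>
        set_distance X (set_iterate F (segment_start l m i + j) y) (set_iterate F j (x i)) \<le> \<epsilon>)"

definition hausdorff_traced :: "'a metric \<Rightarrow> ('a \<times> 'a) set \<Rightarrow> real \<Rightarrow> nat \<Rightarrow> (nat \<Rightarrow> nat) \<Rightarrow>
    (nat \<Rightarrow> 'a) \<Rightarrow> (nat \<Rightarrow> nat) \<Rightarrow> 'a \<Rightarrow> bool" where
  "hausdorff_traced X F \<epsilon> n m x l y \<longleftrightarrow>
     (\<forall>i\<in>{1..n}. \<forall>j\<in>{0..l i}.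
        set_iterate F (segment_start l m i + j) y \<noteq> {} \<and> set_iterate F j (x i) \<noteq> {} \<and>
        hausdorff_distance X (set_iterate F (segment_start l m i + j) y) (set_iterate F j (x i)) \<le> \<epsilon>)"

definition ISP :: "'a metric \<Rightarrow> ('a \<times> 'a) set \<Rightarrow> bool" where
  "ISP X F \<longleftrightarrow>
     (\<forall>\<epsilon>>0. \<exists>N>0. \<forall>n>0. \<forall>m. (\<forall>r\<in>{1..<n}. N \<le> m r) \<longrightarrow>
       (\<forall>x l. (\<forall>i\<in>{1..n}. x i \<in> mspace X) \<longrightarrow>
         (\<exists>y\<in>mspace X. traced X F \<epsilon> n m x l y)))"

definition HISP :: "'a metric \<Rightarrow> ('a \<times> 'a) set \<Rightarrow> bool" where
  "HISP X F \<longleftrightarrow>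
     (\<forall>\<epsilon>>0. \<exists>N>0. \<forall>n>0. \<forall>m. (\<forall>r\<in>{1..<n}. N \<le> m r) \<longrightarrow>
       (\<forall>x l. (\<forall>i\<in>{1..n}. x i \<in> mspace X) \<longrightarrow>
         (\<exists>y\<in>mspace X. hausdorff_traced X F \<epsilon> n m x l y)))"


section \<open>Properties of CR-dynamical systems\<close>

text \<open>A property of CR-dynamical systems is a polymorphic predicate. Since a bound variable is
  monomorphic, invariance under conjugacy takes the instances of the property at the two carrier
  types as separate arguments \<open>P\<close> and \<open>P'\<close>; it is meant to be applied to two instances of one
  polymorphic constant.\<close>

definition CR_dynamical_property ::
    "('a metric \<Rightarrow> ('a \<times> 'a) set \<Rightarrow> bool) \<Rightarrow> ('b metric \<Rightarrow> ('b \<times> 'b) set \<Rightarrow> bool) \<Rightarrow> bool" where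
  "CR_dynamical_property P P' \<longleftrightarrow>
     (\<forall>X F Y G. CR_dynamical_system X F \<and> CR_dynamical_system Y G \<and>
        CR_topologically_conjugate X F Y G \<and> P X F \<longrightarrow> P' Y G)"

definition generalizes ::
    "('a metric \<Rightarrow> ('a \<times> 'a) set \<Rightarrow> bool) \<Rightarrow> ('a metric \<Rightarrow> ('a \<Rightarrow> 'a) \<Rightarrow> bool) \<Rightarrow> bool" where
  "generalizes P R \<longleftrightarrow>
     (\<forall>X f. dynamical_system X f \<longrightarrow> (P X (graph_on X f) \<longleftrightarrow> R X f))"

definition forward_orbits :: "'a metric \<Rightarrow> ('a \<times> 'a) set \<Rightarrow> (nat \<Rightarrow> 'a) topology" where
  "forward_orbits Z F =
     subtopology (product_topology (\<lambda>_. mtopology_of Z) UNIV) {x. \<forall>i. (x i, x (Suc i)) \<in> F}"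

definition shift :: "(nat \<Rightarrow> 'a) \<Rightarrow> nat \<Rightarrow> 'a" where
  "shift x = (\<lambda>i. x (Suc i))"

text \<open>The existential over all CR-dynamical systems \<open>(Z, F)\<close> ranges over compact metric spaces whose
  points are real numbers, with an arbitrary metric (unrelated to the usual one). This is no
  restriction: a compact metric space has at most continuum many points, so it has an isometric
  copy of this kind, as \<open>compact_metric_real_carrier\<close> below shows.\<close>

definition powered_by ::
    "(real metric \<Rightarrow> (real \<times> real) set \<Rightarrow> bool) \<Rightarrow> 'a metric \<Rightarrow> ('a \<Rightarrow> 'a) \<Rightarrow> bool" where
  "powered_by P X f \<longleftrightarrow>
     (\<exists>Z F. CR_dynamical_system Z F \<and> P Z F \<and>
        topologically_conjugate (mtopology_of X) f (forward_orbits Z F) shift)"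

lemma compact_metric_real_carrier:
  fixes X :: "'a metric"
  assumes "compact_space (mtopology_of X)"
  shows "\<exists>(Z :: real metric) h. bij_betw h (mspace X) (mspace Z) \<and>
           (\<forall>x\<in>mspace X. \<forall>y\<in>mspace X. mdist Z (h x) (h y) = mdist X x y)"
proof -
  let ?M = "mspace X" and ?d = "mdist X"
  interpret M: Metric_space ?M ?d
    by (rule Metric_space_mspace_mdist)
  have "M.mtotally_bounded ?M"
    using assms M.compact_space_eq_mcomplete_mtotally_bounded
    by (simp add: mtopology_of_def)
  then have "\<exists>K. finite K \<and> K \<subseteq> ?M \<and> ?M \<subseteq> (\<Union>q\<in>K. M.mball q (inverse (real (Suc n))))" for n
    unfolding M.mtotally_bounded_def by simp
  then obtain K where K: "\<And>n. finite (K n)" "\<And>n. K n \<subseteq> ?M"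
      "\<And>n. ?M \<subseteq> (\<Union>q\<in>K n. M.mball q (inverse (real (Suc n))))"
    by metis
  define Q where "Q = (\<Union>n. K n) \<times> (UNIV :: nat set)"
  have Q: "countable Q"
    unfolding Q_def by (intro countable_SIGMA countable_UN) (auto simp: K countable_finite)
  define c where "c x = {(q, n) \<in> Q. ?d q x < inverse (real (Suc n))}" for x
  have "inj_on c ?M"
  proof (rule inj_onI, rule ccontr)
    fix x y assume xy: "x \<in> ?M" "y \<in> ?M" "c x = c y" "x \<noteq> y"
    then have "0 < ?d x y / 2"
      by (simp add: order_less_le)
    then obtain n where n: "inverse (real (Suc n)) < ?d x y / 2"
      using reals_Archimedean by blast
    obtain q where q: "q \<in> K n" "q \<in> ?M" "?d q x < inverse (real (Suc n))"
      using K(3)[of n] xy(1) by (auto simp: M.in_mball)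
    then have "(q, n) \<in> c x"
      by (auto simp: c_def Q_def)
    then have "?d q y < inverse (real (Suc n))"
      unfolding xy(3) by (simp add: c_def)
    moreover have "?d x y \<le> ?d q x + ?d q y"
      using M.triangle[of x q y] M.commute[of x q] xy q by simp
    ultimately show False
      using n q(3) by linarith
  qed
  moreover have "inj_on (image (to_nat_on Q)) (range c)"
    by (rule inj_on_subset[OF inj_on_image_Pow[OF inj_on_to_nat_on[OF Q]]]) (auto simp: c_def)
  moreover obtain e :: "nat set \<Rightarrow> real" where "bij e"
    using nat_sets_eqpoll_reals unfolding eqpoll_def by blast
  ultimately have inj: "inj_on (\<lambda>x. e (to_nat_on Q ` c x)) ?M"
    by (auto simp: inj_on_def bij_def)
  define h where "h x = e (to_nat_on Q ` c x)" for x
  define g where "g = inv_into ?M h"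
  have g: "g (h x) = x" if "x \<in> ?M" for x
    using inv_into_f_f[OF inj that] by (simp add: g_def h_def[abs_def])
  define Z where "Z = metric (h ` ?M, \<lambda>a b. ?d (g a) (g b))"
  have *: "Metric_space (h ` ?M) (\<lambda>a b. ?d (g a) (g b))"
    by unfold_locales (auto simp: g M.commute M.triangle)
  have "bij_betw h ?M (mspace Z)"
    unfolding bij_betw_def Z_def Metric_space.mspace_metric[OF *]
    using inj by (simp add: h_def[abs_def])
  moreover have "mdist Z (h x) (h y) = ?d x y" if "x \<in> ?M" "y \<in> ?M" for x y
    using that by (simp add: Z_def Metric_space.mdist_metric[OF *] g)
  ultimately show ?thesis
    by blast
qed

end

theory Submission
  imports Defs
begin

text \<open>A homeomorphism of compact metric spaces is uniformly continuous, so it carries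
  \<open>\<delta>\<close>-close sets to \<open>\<epsilon>\<close>-close sets, for the distance and for the
  Hausdorff distance alike; hence tracing transfers along a conjugacy. The iterates of a graph
  at a point are singletons, on which both distances are the metric, so both properties specialize
  to the classical one. Finally, \<open>x \<mapsto> (x, f x, f (f x), \<dots>)\<close> conjugates \<open>(X, f)\<close> to the
  shift on the forward orbits of the graph of \<open>f\<close>, so \<open>(X, f)\<close> is powered by its own graph,
  moved to a real carrier along an isometry.\<close>

section \<open>Specification for an abstract closeness relation\<close>

text \<open>The relation \<open>C \<epsilon> A B\<close> says that \<open>A\<close> and \<open>B\<close> are \<open>\<epsilon>\<close>-close.\<close>

definition has_specification ::
    "(real \<Rightarrow> 'a set \<Rightarrow> 'a set \<Rightarrow> bool) \<Rightarrow> 'a metric \<Rightarrow> ('a \<times> 'a) set \<Rightarrow> bool" where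
  "has_specification C X F \<longleftrightarrow>
     (\<forall>\<epsilon>>0. \<exists>N>0. \<forall>n>0. \<forall>m. (\<forall>r\<in>{1..<n}. N \<le> m r) \<longrightarrow>
       (\<forall>x l. (\<forall>i\<in>{1..n}. x i \<in> mspace X) \<longrightarrow>
         (\<exists>y\<in>mspace X. \<forall>i\<in>{1..n}. \<forall>j\<in>{0..l i}.
            C \<epsilon> (set_iterate F (segment_start l m i + j) y) (set_iterate F j (x i)))))"

text \<open>Non-emptiness is built into closeness, so that \<open>traced\<close> is this relation at
  every time and \<open>ISP\<close> unfolds to an instance of
  \<open>has_specification\<close>.\<close>

definition close :: "'a metric \<Rightarrow> real \<Rightarrow> 'a set \<Rightarrow> 'a set \<Rightarrow> bool" where
  "close X \<epsilon> A B \<longleftrightarrow> A \<noteq> {} \<and> B \<noteq> {} \<and> set_distance X A B \<le> \<epsilon>"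

definition hausdorff_close :: "'a metric \<Rightarrow> real \<Rightarrow> 'a set \<Rightarrow> 'a set \<Rightarrow> bool" where
  "hausdorff_close X \<epsilon> A B \<longleftrightarrow> A \<noteq> {} \<and> B \<noteq> {} \<and> hausdorff_distance X A B \<le> \<epsilon>"

lemma ISP_eq_has_specification: "ISP X F \<longleftrightarrow> has_specification (close X) X F"
  by (simp add: ISP_def has_specification_def traced_def close_def)

lemma HISP_eq_has_specification: "HISP X F \<longleftrightarrow> has_specification (hausdorff_close X) X F"
  by (simp add: HISP_def has_specification_def hausdorff_traced_def hausdorff_close_def)

lemma set_iterate_0 [simp]: "set_iterate F 0 x = {x}"
  by (simp add: set_iterate_def)

lemma set_iterate_Suc [simp]: "set_iterate F (Suc k) x = F `` set_iterate F k x"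
  by (simp add: set_iterate_def)

text \<open>A positive iterate lies in the range of \<open>F\<close>, hence in \<open>S\<close>, and
  the zeroth is \<open>{x}\<close>; a case distinction replaces induction.\<close>

lemma set_iterate_subset:
  assumes "F \<subseteq> S \<times> S" "x \<in> S"
  shows "set_iterate F k x \<subseteq> S"
  using assms by (cases k) auto

lemma set_iterate_image:
  assumes "bij_betw \<phi> S T" "F \<subseteq> S \<times> S" "G \<subseteq> T \<times> T"
    and "\<And>x y. x \<in> S \<Longrightarrow> y \<in> S \<Longrightarrow> (x, y) \<in> F \<longleftrightarrow> (\<phi> x, \<phi> y) \<in> G"
    and "x \<in> S"
  shows "set_iterate G k (\<phi> x) = \<phi> ` set_iterate F k x"
proof (induction k)
  case (Suc k)
  have *: "set_iterate F k x \<subseteq> S"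
    using assms by (intro set_iterate_subset)
  have T: "\<exists>y\<in>S. z = \<phi> y" if "z \<in> T" for z
    using assms(1) that by (auto simp: bij_betw_def)
  \<comment> \<open>A \<open>G\<close>-successor of \<open>\<phi> a\<close> lies in \<open>T\<close>
    and so has a preimage in \<open>S\<close>; only then does the equivalence of edges
    apply.\<close>
  have "G `` (\<phi> ` A) = \<phi> ` (F `` A)" if A: "A \<subseteq> S" for A
  proof (intro equalityI subsetI)
    fix z assume "z \<in> G `` (\<phi> ` A)"
    then obtain a where a: "a \<in> A" "(\<phi> a, z) \<in> G"
      by blast
    then obtain y where "y \<in> S" "z = \<phi> y"
      using T assms(3) by blast
    then show "z \<in> \<phi> ` (F `` A)"
      using a A assms(4)[of a y] by blast
  next
    fix z assume "z \<in> \<phi> ` (F `` A)"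
    then obtain a y where "a \<in> A" "(a, y) \<in> F" "z = \<phi> y"
      by blast
    then show "z \<in> G `` (\<phi> ` A)"
      using A assms(2) assms(4)[of a y] by blast
  qed
  then show ?case
    using Suc * by simp
qed simp

text \<open>Pull the given points back along \<open>\<phi>\<close>, trace them in \<open>X\<close>
  to precision \<delta>, and push the tracing point forward. Since \<delta> depends on \<epsilon>
  alone, the gap bound is uniform over all specifications.\<close>

lemma has_specification_transfer:
  assumes bij: "bij_betw \<phi> (mspace X) (mspace Y)"
    and F: "F \<subseteq> mspace X \<times> mspace X" and G: "G \<subseteq> mspace Y \<times> mspace Y"
    and iff: "\<And>x y. x \<in> mspace X \<Longrightarrow> y \<in> mspace X \<Longrightarrow> (x, y) \<in> F \<longleftrightarrow> (\<phi> x, \<phi> y) \<in> G"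
    and C: "\<And>\<epsilon>. 0 < \<epsilon> \<Longrightarrow> \<exists>\<delta>>0. \<forall>A B. A \<subseteq> mspace X \<longrightarrow> B \<subseteq> mspace X \<longrightarrow>
              C \<delta> A B \<longrightarrow> D \<epsilon> (\<phi> ` A) (\<phi> ` B)"
    and spec: "has_specification C X F"
  shows "has_specification D Y G"
  unfolding has_specification_def
proof (intro allI impI)
  fix \<epsilon> :: real assume "0 < \<epsilon>"
  then obtain \<delta> where "0 < \<delta>"
    and \<delta>: "\<And>A B. A \<subseteq> mspace X \<Longrightarrow> B \<subseteq> mspace X \<Longrightarrow> C \<delta> A B \<Longrightarrow> D \<epsilon> (\<phi> ` A) (\<phi> ` B)"
    using C by blast
  \<comment> \<open>The gap bound for \<delta> in \<open>X\<close> serves \<epsilon> in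
    \<open>Y\<close>: lengths and gaps are unchanged, so the segments start at the same
    times.\<close>
  obtain N where "0 < N" and N: "\<And>n m x l. 0 < n \<Longrightarrow> \<forall>r\<in>{1..<n}. N \<le> m r \<Longrightarrow>
      \<forall>i\<in>{1..n}. x i \<in> mspace X \<Longrightarrow>
      \<exists>y\<in>mspace X. \<forall>i\<in>{1..n}. \<forall>j\<in>{0..l i}.
        C \<delta> (set_iterate F (segment_start l m i + j) y) (set_iterate F j (x i))"
    using spec \<open>0 < \<delta>\<close> unfolding has_specification_def by metis
  have image: "set_iterate G k (\<phi> x) = \<phi> ` set_iterate F k x" if "x \<in> mspace X" for k x
    using iff by (intro set_iterate_image[OF bij F G _ that])
  have "\<exists>y\<in>mspace Y. \<forall>i\<in>{1..n}. \<forall>j\<in>{0..l i}.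
          D \<epsilon> (set_iterate G (segment_start l m i + j) y) (set_iterate G j (x i))"
    if asm: "0 < n" "\<forall>r\<in>{1..<n}. N \<le> m r" "\<forall>i\<in>{1..n}. x i \<in> mspace Y"
    for n m l and x :: "nat \<Rightarrow> 'b"
  proof -
    define x' where "x' i = inv_into (mspace X) \<phi> (x i)" for i
    have x': "x' i \<in> mspace X" "\<phi> (x' i) = x i" if "i \<in> {1..n}" for i
      using that asm(3) bij unfolding x'_def bij_betw_def
      by (metis inv_into_into, metis f_inv_into_f)
    obtain y where y: "y \<in> mspace X" and
      tr: "\<And>i j. i \<in> {1..n} \<Longrightarrow> j \<in> {0..l i} \<Longrightarrow>
        C \<delta> (set_iterate F (segment_start l m i + j) y) (set_iterate F j (x' i))"
      using N[OF asm(1,2), of x' l] x'(1) by blast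
    have "D \<epsilon> (set_iterate G (segment_start l m i + j) (\<phi> y)) (set_iterate G j (x i))"
      if "i \<in> {1..n}" "j \<in> {0..l i}" for i j
    proof -
      have "D \<epsilon> (\<phi> ` set_iterate F (segment_start l m i + j) y) (\<phi> ` set_iterate F j (x' i))"
        using that y x' F by (intro \<delta> tr set_iterate_subset)
      then show ?thesis
        using image[OF y] image[OF x'(1)] x'(2) that by simp
    qed
    moreover have "\<phi> y \<in> mspace Y"
      using bij y by (auto simp: bij_betw_def)
    ultimately show ?thesis
      by blast
  qed
  then show "\<exists>N>0. \<forall>n>0. \<forall>m. (\<forall>r\<in>{1..<n}. N \<le> m r) \<longrightarrow>
       (\<forall>x l. (\<forall>i\<in>{1..n}. x i \<in> mspace Y) \<longrightarrow>
         (\<exists>y\<in>mspace Y. \<forall>i\<in>{1..n}. \<forall>j\<in>{0..l i}.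
            D \<epsilon> (set_iterate G (segment_start l m i + j) y) (set_iterate G j (x i))))"
    using \<open>0 < N\<close> by blast
qed

section \<open>Invariance under conjugacy\<close>

lemma set_distance_le:
  assumes "a \<in> A" "b \<in> B"
  shows "set_distance X A B \<le> mdist X a b"
  unfolding set_distance_def
  using assms by (intro cInf_lower bdd_belowI[of _ 0]) auto

text \<open>The infimum need not be attained, so a strict bound is what yields a pair of
  points.\<close>

lemma set_distance_lessD:
  assumes "set_distance X A B < r" "A \<noteq> {}" "B \<noteq> {}"
  obtains a b where "a \<in> A" "b \<in> B" "mdist X a b < r"
proof -
  have "{mdist X a b |a b. a \<in> A \<and> b \<in> B} \<noteq> {}"
    using assms by auto
  from cInf_lessD[OF this] assms(1) show thesis
    unfolding set_distance_def using that by auto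
qed

lemma hausdorff_distance_le:
  assumes "0 < r" "A \<subseteq> (\<Union>b\<in>B. mball_of X b r)" "B \<subseteq> (\<Union>a\<in>A. mball_of X a r)"
  shows "hausdorff_distance X A B \<le> r"
  unfolding hausdorff_distance_def
  using assms by (intro cInf_lower bdd_belowI[of _ 0]) auto

text \<open>Compactness is needed here: on an unbounded space the infimum defining the Hausdorff
  distance may range over the empty set.\<close>

lemma hausdorff_distance_lessD:
  assumes "hausdorff_distance X A B < s" "A \<noteq> {}" "B \<noteq> {}" "A \<subseteq> mspace X" "B \<subseteq> mspace X"
    and "compact_space (mtopology_of X)"
  shows "A \<subseteq> (\<Union>b\<in>B. mball_of X b s)" "B \<subseteq> (\<Union>a\<in>A. mball_of X a s)"
proof -
  interpret M: Metric_space "mspace X" "mdist X"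
    by (rule Metric_space_mspace_mdist)
  let ?R = "{r. 0 < r \<and> A \<subseteq> (\<Union>b\<in>B. mball_of X b r) \<and> B \<subseteq> (\<Union>a\<in>A. mball_of X a r)}"
  have "M.mbounded (mspace X)"
    using assms(6) M.compactin_imp_mbounded
    by (simp add: compact_space_def mtopology_of_def)
  then obtain K where K: "0 < K" "\<And>x y. x \<in> mspace X \<Longrightarrow> y \<in> mspace X \<Longrightarrow> mdist X x y \<le> K"
    by (auto simp: M.mbounded_alt_pos)
  \<comment> \<open>\<open>K\<close> bounds the diameter only weakly while balls are open, hence
    \<open>K + 1\<close> as an admissible radius.\<close>
  have "mdist X x y < K + 1" if "x \<in> mspace X" "y \<in> mspace X" for x y
    using K(2)[OF that] by simp
  then have "K + 1 \<in> ?R"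
    using K(1) assms(2-5) by (fastforce simp: subset_iff)
  then have "?R \<noteq> {}"
    by blast
  from cInf_lessD[OF this] assms(1) obtain r where "r \<in> ?R" "r < s"
    unfolding hausdorff_distance_def by blast
  then show "A \<subseteq> (\<Union>b\<in>B. mball_of X b s)" "B \<subseteq> (\<Union>a\<in>A. mball_of X a s)"
    by fastforce+
qed

section \<open>Close sets under uniformly continuous maps\<close>

text \<open>A pair of points closer than the modulus of continuity is mapped to an \<epsilon>-close
  pair, and one pair bounds the infimum.\<close>

lemma close_image:
  assumes "uniformly_continuous_map X Y \<phi>" "0 < \<epsilon>"
  shows "\<exists>\<delta>>0. \<forall>A B. A \<subseteq> mspace X \<longrightarrow> B \<subseteq> mspace X \<longrightarrow>
           close X \<delta> A B \<longrightarrow> close Y \<epsilon> (\<phi> ` A) (\<phi> ` B)"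
proof -
  obtain \<delta> where "0 < \<delta>" and \<delta>: "\<And>x y. x \<in> mspace X \<Longrightarrow> y \<in> mspace X \<Longrightarrow>
      mdist X x y < \<delta> \<Longrightarrow> mdist Y (\<phi> x) (\<phi> y) < \<epsilon>"
    using assms unfolding uniformly_continuous_map_def by meson
  \<comment> \<open>Halving \<delta> turns the weak bound in \<open>close\<close> into the strict
    one that uniform continuity asks for.\<close>
  have "close Y \<epsilon> (\<phi> ` A) (\<phi> ` B)"
    if AB: "A \<subseteq> mspace X" "B \<subseteq> mspace X" "close X (\<delta> / 2) A B" for A B
  proof -
    have "set_distance X A B < \<delta>" "A \<noteq> {}" "B \<noteq> {}"
      using AB(3) \<open>0 < \<delta>\<close> by (auto simp: close_def)
    then obtain a b where ab: "a \<in> A" "b \<in> B" "mdist X a b < \<delta>"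
      by (rule set_distance_lessD)
    have "set_distance Y (\<phi> ` A) (\<phi> ` B) \<le> mdist Y (\<phi> a) (\<phi> b)"
      using ab by (intro set_distance_le) auto
    also have "\<dots> < \<epsilon>"
      using ab AB by (intro \<delta>) auto
    finally show ?thesis
      using \<open>A \<noteq> {}\<close> \<open>B \<noteq> {}\<close> by (simp add: close_def)
  qed
  then show ?thesis
    using \<open>0 < \<delta>\<close> half_gt_zero by blast
qed

text \<open>Each \<delta>-ball is carried into the \<epsilon>-ball about the image of its centre, so
  mutual covers pass to the images. Compactness allows such covers to be read off from the Hausdorff
  distance.\<close>

lemma hausdorff_close_image:
  assumes "uniformly_continuous_map X Y \<phi>" "0 < \<epsilon>" "compact_space (mtopology_of X)"
  shows "\<exists>\<delta>>0. \<forall>A B. A \<subseteq> mspace X \<longrightarrow> B \<subseteq> mspace X \<longrightarrow>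
           hausdorff_close X \<delta> A B \<longrightarrow> hausdorff_close Y \<epsilon> (\<phi> ` A) (\<phi> ` B)"
proof -
  obtain \<delta> where "0 < \<delta>" and \<delta>: "\<And>x y. x \<in> mspace X \<Longrightarrow> y \<in> mspace X \<Longrightarrow>
      mdist X x y < \<delta> \<Longrightarrow> mdist Y (\<phi> x) (\<phi> y) < \<epsilon>"
    using assms unfolding uniformly_continuous_map_def by meson
  have Y: "\<phi> x \<in> mspace Y" if "x \<in> mspace X" for x
    using assms(1) that by (auto simp: uniformly_continuous_map_def)
  \<comment> \<open>Stated for one inclusion, so that it serves both halves of the Hausdorff
    distance.\<close>
  have image: "\<phi> ` A \<subseteq> (\<Union>b\<in>\<phi> ` B. mball_of Y b \<epsilon>)" if AB: "A \<subseteq> (\<Union>b\<in>B. mball_of X b \<delta>)" for A B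
  proof
    fix z assume "z \<in> \<phi> ` A"
    then obtain a b where "a \<in> A" "z = \<phi> a" "b \<in> B" "a \<in> mball_of X b \<delta>"
      using AB by blast
    then show "z \<in> (\<Union>b\<in>\<phi> ` B. mball_of Y b \<epsilon>)"
      by (auto intro!: bexI[of _ b] \<delta> Y)
  qed
  have "hausdorff_close Y \<epsilon> (\<phi> ` A) (\<phi> ` B)"
    if AB: "A \<subseteq> mspace X" "B \<subseteq> mspace X" "hausdorff_close X (\<delta> / 2) A B" for A B
  proof -
    have *: "hausdorff_distance X A B < \<delta>" "A \<noteq> {}" "B \<noteq> {}"
      using AB(3) \<open>0 < \<delta>\<close> by (auto simp: hausdorff_close_def)
    have "hausdorff_distance Y (\<phi> ` A) (\<phi> ` B) \<le> \<epsilon>"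
      using hausdorff_distance_lessD[OF * AB(1,2) assms(3)] assms(2)
      by (intro hausdorff_distance_le image)
    then show ?thesis
      using * by (simp add: hausdorff_close_def)
  qed
  then show ?thesis
    using \<open>0 < \<delta>\<close> half_gt_zero by blast
qed

lemma CR_dynamical_system_subset:
  assumes "CR_dynamical_system X F"
  shows "F \<subseteq> mspace X \<times> mspace X"
  using assms closedin_subset unfolding CR_dynamical_system_def by fastforce

text \<open>Compactness of \<open>X\<close> makes the conjugating homeomorphism uniformly
  continuous. The closeness hypothesis covers all such maps because the conjugacy is chosen inside
  the proof.\<close>

lemma has_specification_conjugate:
  assumes X: "CR_dynamical_system X F" and Y: "CR_dynamical_system Y G"
    and conj: "CR_topologically_conjugate X F Y G"
    and C: "\<And>\<phi> \<epsilon>. uniformly_continuous_map X Y \<phi> \<Longrightarrow> 0 < \<epsilon> \<Longrightarrow>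
              \<exists>\<delta>>0. \<forall>A B. A \<subseteq> mspace X \<longrightarrow> B \<subseteq> mspace X \<longrightarrow>
                C \<delta> A B \<longrightarrow> D \<epsilon> (\<phi> ` A) (\<phi> ` B)"
    and spec: "has_specification C X F"
  shows "has_specification D Y G"
proof -
  obtain \<phi> where \<phi>: "homeomorphic_map (mtopology_of X) (mtopology_of Y) \<phi>"
    and iff: "\<And>x y. x \<in> mspace X \<Longrightarrow> y \<in> mspace X \<Longrightarrow> (x, y) \<in> F \<longleftrightarrow> (\<phi> x, \<phi> y) \<in> G"
    using conj unfolding CR_topologically_conjugate_def by blast
  have "bij_betw \<phi> (mspace X) (mspace Y)"
    using homeomorphic_imp_injective_map[OF \<phi>] homeomorphic_imp_surjective_map[OF \<phi>]
    by (simp add: bij_betw_def)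
  moreover have "uniformly_continuous_map X Y \<phi>"
    using X homeomorphic_imp_continuous_map[OF \<phi>]
    by (simp add: CR_dynamical_system_def continuous_eq_uniformly_continuous_map)
  ultimately show ?thesis
    using iff by (intro has_specification_transfer[OF _ CR_dynamical_system_subset[OF X]
          CR_dynamical_system_subset[OF Y] _ _ spec] C)
qed

lemma CR_dynamical_property_ISP: "CR_dynamical_property ISP ISP"
  unfolding CR_dynamical_property_def ISP_eq_has_specification
proof (intro allI impI, elim conjE)
  fix X :: "'a metric" and Y :: "'b metric" and F G
  assume "CR_dynamical_system X F" "CR_dynamical_system Y G"
    "CR_topologically_conjugate X F Y G" "has_specification (close X) X F"
  then show "has_specification (close Y) Y G"
    by (intro has_specification_conjugate[where C = "close X" and D = "close Y",
          OF _ _ _ close_image])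
qed

lemma CR_dynamical_property_HISP: "CR_dynamical_property HISP HISP"
  unfolding CR_dynamical_property_def HISP_eq_has_specification
proof (intro allI impI, elim conjE)
  fix X :: "'a metric" and Y :: "'b metric" and F G
  assume X: "CR_dynamical_system X F" and *: "CR_dynamical_system Y G"
    "CR_topologically_conjugate X F Y G" "has_specification (hausdorff_close X) X F"
  then have "compact_space (mtopology_of X)"
    by (simp add: CR_dynamical_system_def)
  with X * show "has_specification (hausdorff_close Y) Y G"
    by (intro has_specification_conjugate[where C = "hausdorff_close X" and
          D = "hausdorff_close Y", OF _ _ _ hausdorff_close_image])
qed

section \<open>Graphs of continuous maps\<close>

lemma dynamical_system_maps:
  assumes "dynamical_system X f" "x \<in> mspace X"
  shows "f x \<in> mspace X"
  using assms continuous_map_image_subset_topspace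
  unfolding dynamical_system_def by fastforce

lemma dynamical_system_funpow:
  assumes "dynamical_system X f" "x \<in> mspace X"
  shows "(f ^^ k) x \<in> mspace X"
  using assms by (induction k) (auto intro: dynamical_system_maps)

text \<open>In a graph each point of the space has exactly one successor, again in the space, so
  singletons stay singletons.\<close>

lemma set_iterate_graph_on:
  assumes "dynamical_system X f" "x \<in> mspace X"
  shows "set_iterate (graph_on X f) k x = {(f ^^ k) x}"
  using dynamical_system_funpow[OF assms]
  by (induction k) (auto simp: graph_on_def)

lemma has_specification_graph_on:
  assumes f: "dynamical_system X f"
    and C: "\<And>\<epsilon> a b. a \<in> mspace X \<Longrightarrow> b \<in> mspace X \<Longrightarrow> C \<epsilon> {a} {b} \<longleftrightarrow> mdist X a b \<le> \<epsilon>"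
  shows "has_specification C X (graph_on X f) \<longleftrightarrow> initial_specification_property X f"
  unfolding has_specification_def initial_specification_property_def
  \<comment> \<open>The congruence rules strip the common quantifiers; \<open>add.commute\<close>
    reconciles the two orders of summands in the exponents.\<close>
  by (intro all_cong1 imp_cong ex_cong1 conj_cong bex_cong ball_cong refl)
    (simp add: set_iterate_graph_on[OF f] C dynamical_system_funpow[OF f] add.commute)

lemma close_singletons: "close X \<epsilon> {a} {b} \<longleftrightarrow> mdist X a b \<le> \<epsilon>"
  by (simp add: close_def set_distance_def)

text \<open>The admissible radii form the open ray above \<open>mdist X a b\<close>, whose infimum
  is its endpoint.\<close>

lemma hausdorff_close_singletons:
  assumes "a \<in> mspace X" "b \<in> mspace X"
  shows "hausdorff_close X \<epsilon> {a} {b} \<longleftrightarrow> mdist X a b \<le> \<epsilon>"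
proof -
  have "{r. 0 < r \<and> {a} \<subseteq> (\<Union>b\<in>{b}. mball_of X b r) \<and> {b} \<subseteq> (\<Union>a\<in>{a}. mball_of X a r)}
      = {mdist X a b<..}"
    using assms mdist_nonneg[of X a b] by (auto simp: mdist_commute simp del: mdist_nonneg)
  then show ?thesis
    by (simp add: hausdorff_close_def hausdorff_distance_def)
qed

lemma generalizes_ISP: "generalizes ISP initial_specification_property"
  by (simp add: generalizes_def ISP_eq_has_specification has_specification_graph_on close_singletons)

lemma generalizes_HISP: "generalizes HISP initial_specification_property"
  by (simp add: generalizes_def HISP_eq_has_specification has_specification_graph_on
      hausdorff_close_singletons)

text \<open>The graph is the set where the continuous maps \<open>f \<circ> fst\<close> and
  \<open>snd\<close> agree, which is closed because the metric topology is Hausdorff.\<close>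

lemma CR_dynamical_system_graph_on:
  assumes "dynamical_system X f"
  shows "CR_dynamical_system X (graph_on X f)"
proof -
  let ?T = "mtopology_of X"
  have f: "continuous_map ?T ?T f"
    using assms by (simp add: dynamical_system_def)
  have "closedin (prod_topology ?T ?T)
      {p \<in> topspace (prod_topology ?T ?T). (f \<circ> fst) p = snd p}"
    using Metric_space.Hausdorff_space_mtopology[OF Metric_space_mspace_mdist]
    by (intro closedin_continuous_maps_eq[where Y = ?T] continuous_map_compose[OF _ f]
        continuous_map_fst continuous_map_snd) (simp add: mtopology_of_def)
  also have "{p \<in> topspace (prod_topology ?T ?T). (f \<circ> fst) p = snd p} = graph_on X f"
    using dynamical_system_maps[OF assms] by (auto simp: graph_on_def)
  finally show ?thesis
    using assms by (simp add: CR_dynamical_system_def dynamical_system_def)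
qed

section \<open>Powers\<close>

lemma topologically_conjugate_trans:
  assumes "topologically_conjugate S f T g" "topologically_conjugate T g U h"
  shows "topologically_conjugate S f U h"
proof -
  obtain \<phi> \<psi> where \<phi>: "homeomorphic_map S T \<phi>" "\<forall>x\<in>topspace S. \<phi> (f x) = g (\<phi> x)"
    and \<psi>: "homeomorphic_map T U \<psi>" "\<forall>x\<in>topspace T. \<psi> (g x) = h (\<psi> x)"
    using assms unfolding topologically_conjugate_def by blast
  have "homeomorphic_map S U (\<psi> \<circ> \<phi>)"
    by (rule homeomorphic_map_compose[OF \<phi>(1) \<psi>(1)])
  moreover have "\<phi> x \<in> topspace T" if "x \<in> topspace S" for x
    using homeomorphic_imp_surjective_map[OF \<phi>(1)] that by blast
  ultimately show ?thesis
    unfolding topologically_conjugate_def using \<phi>(2) \<psi>(2)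
    by (intro exI[of _ "\<psi> \<circ> \<phi>"]) simp
qed

text \<open>Intertwining the maps preserves edges; injectivity of the homeomorphism gives that edges
  are also reflected.\<close>

lemma CR_topologically_conjugate_graph_on:
  assumes f: "dynamical_system X f"
    and "topologically_conjugate (mtopology_of X) f (mtopology_of Y) g"
  shows "CR_topologically_conjugate X (graph_on X f) Y (graph_on Y g)"
proof -
  obtain \<phi> where \<phi>: "homeomorphic_map (mtopology_of X) (mtopology_of Y) \<phi>"
    and eq: "\<And>x. x \<in> mspace X \<Longrightarrow> \<phi> (f x) = g (\<phi> x)"
    using assms(2) unfolding topologically_conjugate_def by auto
  have inj: "inj_on \<phi> (mspace X)" and im: "\<phi> ` mspace X = mspace Y"
    using homeomorphic_imp_injective_map[OF \<phi>] homeomorphic_imp_surjective_map[OF \<phi>] by simp_all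
  have "(x, y) \<in> graph_on X f \<longleftrightarrow> (\<phi> x, \<phi> y) \<in> graph_on Y g"
    if "x \<in> mspace X" "y \<in> mspace X" for x y
  proof -
    have "(\<phi> x, \<phi> y) \<in> graph_on Y g \<longleftrightarrow> \<phi> y = \<phi> (f x)"
      using that im eq by (auto simp: graph_on_def)
    also have "\<dots> \<longleftrightarrow> y = f x"
      using that inj dynamical_system_maps[OF f] by (auto dest: inj_onD)
    finally show ?thesis
      using that by (auto simp: graph_on_def)
  qed
  then show ?thesis
    using \<phi> unfolding CR_topologically_conjugate_def by blast
qed

lemma forward_orbits_graph_on:
  assumes f: "dynamical_system X f"
  shows "topologically_conjugate (mtopology_of X) f (forward_orbits X (graph_on X f)) shift"
proof -
  let ?T = "mtopology_of X" and ?O = "forward_orbits X (graph_on X f)"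
  define \<phi> where "\<phi> x = (\<lambda>i. (f ^^ i) x)" for x
  have "continuous_map ?T ?T (f ^^ i)" for i
  proof (induction i)
    case (Suc i)
    then show ?case
      using f continuous_map_compose[of ?T ?T "f ^^ i" ?T f] by (simp add: dynamical_system_def o_def)
  qed (simp add: id_def)
  \<comment> \<open>Continuity into the product is checked coordinatewise, where it is continuity of
    the iterates.\<close>
  then have "continuous_map ?T ?O \<phi>"
    using dynamical_system_funpow[OF f]
    by (auto simp: forward_orbits_def continuous_map_in_subtopology
        continuous_map_componentwise_UNIV \<phi>_def graph_on_def)
  moreover have "continuous_map ?O ?T (\<lambda>z. z 0)"
    unfolding forward_orbits_def
    by (intro continuous_map_from_subtopology continuous_map_product_projection) simp
  \<comment> \<open>An orbit in a graph is determined by its first point, so evaluation at 0 inverts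
    \<open>\<phi>\<close>.\<close>
  moreover have "\<phi> (z 0) = z" if "z \<in> topspace ?O" for z
  proof
    have "z (Suc i) = f (z i)" for i
      using that by (auto simp: forward_orbits_def graph_on_def)
    then show "\<phi> (z 0) i = z i" for i
      unfolding \<phi>_def by (induction i) auto
  qed
  ultimately have "homeomorphic_maps ?T ?O \<phi> (\<lambda>z. z 0)"
    by (simp add: homeomorphic_maps_def \<phi>_def)
  then have "homeomorphic_map ?T ?O \<phi>"
    by (auto simp: homeomorphic_map_maps)
  moreover have "\<phi> (f x) = shift (\<phi> x)" for x
    by (simp add: \<phi>_def shift_def funpow_swap1)
  ultimately show ?thesis
    unfolding topologically_conjugate_def by blast
qed

section \<open>Transport of a system to a real carrier\<close>

lemma homeomorphic_dynamical_system:
  assumes f: "dynamical_system X f"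
    and maps: "homeomorphic_maps (mtopology_of X) (mtopology_of Y) h k"
  shows "dynamical_system Y (h \<circ> f \<circ> k)"
    and "topologically_conjugate (mtopology_of X) f (mtopology_of Y) (h \<circ> f \<circ> k)"
proof -
  let ?X = "mtopology_of X" and ?Y = "mtopology_of Y"
  have h: "continuous_map ?X ?Y h" and k: "continuous_map ?Y ?X k"
    and kh: "\<And>x. x \<in> mspace X \<Longrightarrow> k (h x) = x" and hom: "homeomorphic_map ?X ?Y h"
    using maps by (auto simp: homeomorphic_maps_def homeomorphic_map_maps)
  have im: "h ` mspace X = mspace Y"
    using homeomorphic_imp_surjective_map[OF hom] by simp
  have "compact_space ?Y"
    using f homeomorphic_compact_space homeomorphic_map_imp_homeomorphic_space[OF hom]
    unfolding dynamical_system_def by blast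
  moreover have "continuous_map ?Y ?Y (h \<circ> f \<circ> k)"
    using f h k unfolding dynamical_system_def by (blast intro: continuous_map_compose)
  ultimately show "dynamical_system Y (h \<circ> f \<circ> k)"
    using f im unfolding dynamical_system_def by blast
  show "topologically_conjugate ?X f ?Y (h \<circ> f \<circ> k)"
    unfolding topologically_conjugate_def using hom kh by (intro exI[of _ h]) auto
qed

lemma isometry_imp_homeomorphic_map_of:
  assumes "bij_betw h (mspace X) (mspace Y)"
    and "\<And>x y. x \<in> mspace X \<Longrightarrow> y \<in> mspace X \<Longrightarrow> mdist Y (h x) (h y) = mdist X x y"
  shows "homeomorphic_map (mtopology_of X) (mtopology_of Y) h"
proof -
  interpret Metric_space12 "mspace X" "mdist X" "mspace Y" "mdist Y"
    by (simp add: Metric_space12_def)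
  show ?thesis
    using isometry_imp_homeomorphic_map[of h] assms
    by (simp add: bij_betw_def mtopology_of_def)
qed

text \<open>The witness is the graph of the conjugate map on an isometric real copy of
  \<open>X\<close>. \<open>P\<close> and \<open>P'\<close> represent one property at the types
  \<open>'a\<close> and \<open>real\<close>: \<open>gen\<close> gives it for the graph on
  \<open>X\<close>, and \<open>inv\<close> moves it to the copy.\<close>

lemma powered_by_graph:
  fixes P :: "'a metric \<Rightarrow> ('a \<times> 'a) set \<Rightarrow> bool" and f :: "'a \<Rightarrow> 'a"
  assumes f: "dynamical_system X f" and spec: "initial_specification_property X f"
    and inv: "CR_dynamical_property P P'" and gen: "generalizes P initial_specification_property"
  shows "powered_by P' X f"
proof -
  obtain Z :: "real metric" and h where h: "bij_betw h (mspace X) (mspace Z)"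
      "\<forall>x\<in>mspace X. \<forall>y\<in>mspace X. mdist Z (h x) (h y) = mdist X x y"
    using compact_metric_real_carrier[of X] f unfolding dynamical_system_def by blast
  then obtain k where hk: "homeomorphic_maps (mtopology_of X) (mtopology_of Z) h k"
    using isometry_imp_homeomorphic_map_of[of h X Z] unfolding homeomorphic_map_maps by blast
  define g where "g = h \<circ> f \<circ> k"
  have g: "dynamical_system Z g" and
      conj: "topologically_conjugate (mtopology_of X) f (mtopology_of Z) g"
    unfolding g_def by (rule homeomorphic_dynamical_system[OF f hk])+
  have "P X (graph_on X f)"
    using gen f spec by (simp add: generalizes_def)
  then have "P' Z (graph_on Z g)"
    using inv CR_dynamical_system_graph_on[OF f] CR_dynamical_system_graph_on[OF g]
      CR_topologically_conjugate_graph_on[OF f conj]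
    unfolding CR_dynamical_property_def by blast
  then show ?thesis
    unfolding powered_by_def
    using CR_dynamical_system_graph_on[OF g]
      topologically_conjugate_trans[OF conj forward_orbits_graph_on[OF g]] by blast
qed

theorem theorem5p5:
  shows "CR_dynamical_property (ISP :: 'a metric \<Rightarrow> _) (ISP :: 'b metric \<Rightarrow> _) \<and>
         generalizes (ISP :: 'a metric \<Rightarrow> _) initial_specification_property \<and>
         (\<forall>(X :: 'a metric) f. dynamical_system X f \<and> initial_specification_property X f \<longrightarrow>
            powered_by ISP X f) \<and>
         CR_dynamical_property (HISP :: 'a metric \<Rightarrow> _) (HISP :: 'b metric \<Rightarrow> _) \<and>
         generalizes (HISP :: 'a metric \<Rightarrow> _) initial_specification_property \<and>
         (\<forall>(X :: 'a metric) f. dynamical_system X f \<and> initial_specification_property X f \<longrightarrow>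
            powered_by HISP X f)"
  by (intro conjI allI impI CR_dynamical_property_ISP CR_dynamical_property_HISP
      generalizes_ISP generalizes_HISP)
    (blast intro: powered_by_graph CR_dynamical_property_ISP CR_dynamical_property_HISP
      generalizes_ISP generalizes_HISP)+

end
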